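(* Let $k\geq 100$ be an odd integer. Let $G$ be a graph on $n$ vertices with $g_{\text{odd}}\geq k$. If $\lambda_1\geq 16n/k$, then $$\frac{\lambda_1+\lambda_n}{n}\leq 4\cdot 2^{-\frac{k\lambda_1}{16n}}.$$
   Context: All graphs are finite and simple. For a graph $G$ on $n\ge 1$ vertices, $\lambda_1\geq\dots\geq\lambda_n$ denote the eigenvalues (with multiplicity) of its adjacency matrix $A(G)$. The odd girth $g_{\text{odd}}$ of $G$ is the length of the shortest odd cycle in $G$, with $g_{\text{odd}}=\infty$ if $G$ has no odd cycles. *)

theory Defs
  imports "Jordan_Normal_Form.Char_Poly" "Graph_Theory.Pair_Digraph"
begin

text \<open>
  A finite simple graph is a \<^locale>\<open>pair_graph\<close>: a finite vertex set together with a symmetric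
  irreflexive set of arcs, so that an edge \<open>uv\<close> is represented by the two arcs
  \<open>(u, v)\<close> and \<open>(v, u)\<close>.

  The library predicate \<^const>\<open>pre_digraph.cycle\<close> also accepts the closed walks \<open>u, v, u\<close> that
  traverse one edge back and forth.  They have length 2 and do not affect the odd girth; there are
  no loops, so an odd cycle in this sense has length at least 3 and is a cycle of the graph.
  If there is no odd cycle, the infimum is over the empty set and equals \<open>\<infinity>\<close>.
\<close>

definition odd_girth :: "'a pair_pre_digraph \<Rightarrow> enat" where
  "odd_girth G = (INF p \<in> {p. pre_digraph.cycle (with_proj G) p \<and> odd (length p)}. enat (length p))"

text \<open>The list \<open>vs\<close> enumerates the vertices, thereby fixing the order of the rows and columns.\<close>

definition adjacency_mat :: "'a pair_pre_digraph \<Rightarrow> 'a list \<Rightarrow> real mat" where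
  "adjacency_mat G vs =
     mat (length vs) (length vs) (\<lambda>(i, j). if (vs ! i, vs ! j) \<in> parcs G then 1 else 0)"

text \<open>
  \<open>eig A i\<close> is the \<open>i\<close>-th largest real eigenvalue of \<open>A\<close>, counted with multiplicity as a root of the
  characteristic polynomial, for \<open>i = 1, 2, \<dots>\<close>.  A symmetric real matrix of dimension \<open>n\<close>
  has \<open>n\<close> such roots, so that \<open>eig A n\<close> is its smallest eigenvalue.
\<close>

definition eig :: "real mat \<Rightarrow> nat \<Rightarrow> real" where
  "eig A i = rev (sorted_list_of_multiset (proots (char_poly A))) ! (i - 1)"

end

theory Submission
  imports Defs "HOL-Analysis.Function_Topology" "HOL-Analysis.Convex"
begin

text \<open>
  Write \<open>\<rho>\<close> for the largest and \<open>\<mu>\<close> for the smallest adjacency eigenvalue.  The idea is to find a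
  ball of \<open>G\<close> that induces a bipartite subgraph and still carries almost all of the spectral radius:
  the spectrum of a bipartite graph is symmetric about 0, so such a ball forces \<open>\<mu>\<close> down to almost
  \<open>- \<rho>\<close>.

  Let \<open>x\<close> be an eigenfunction of \<open>\<rho>\<close> with values in \<open>[0, 1]\<close> and \<open>x v = 1\<close>, and let \<open>N i\<close> be the set of
  vertices at distance \<open>i\<close> from \<open>v\<close>.  An edge inside \<open>N i\<close> closes up to an odd closed walk of length
  \<open>2 i + 1\<close>, hence gives an odd cycle of at most that length.  So the layers up to \<open>R = (k - 3) / 2\<close> are
  independent (\<open>layer_independent\<close>), and the ball of radius \<open>i \<le> R\<close> is bipartite.  Put
  \<open>mass i = \<Sum>u\<in>N i. (x u)\<^sup>2\<close> and let \<open>cut i\<close> be the sum of \<open>x u * x w\<close> over the edges \<open>uw\<close> between \<open>N i\<close>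
  and \<open>N (i + 1)\<close>.  The function that is \<open>x\<close> on the even and \<open>- x\<close> on the odd layers of the ball, and 0
  outside it, has Rayleigh quotient \<open>- \<rho> + cut i / (\<Sum>j\<le>i. mass j)\<close>
  (\<open>smallest_eigenvalue_cut\<close>).  It remains to find a radius at which the cut is exponentially small.

  The eigenvalue equation, summed over a layer, gives \<open>\<rho> * mass i = cut (i - 1) + cut i\<close>, and the
  Cauchy-Schwarz inequality gives \<open>(cut i)\<^sup>2 \<le> |N i| * |N (i + 1)| * mass i * mass (i + 1)\<close>.
  If \<open>|N i| + |N (i + 1)| \<le> 2 \<rho> / 5\<close>, the two combine to
  \<open>25 (cut i)\<^sup>2 \<le> (cut (i - 1) + cut i) * (cut i + cut (i + 1))\<close>, so that \<open>cut i\<close> is at most a quarter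
  of the larger of its two neighbours.  Along a run of small layers the cuts therefore decay
  geometrically from both ends towards the middle (\<open>cut_decay\<close>).  The layers share \<open>n\<close> vertices and there
  are about \<open>k / 2\<close> of them, so with \<open>t = k \<rho> / (16 n)\<close> the pigeonhole principle provides a run of
  \<open>\<lfloor>t\<rfloor> + 1\<close> layers whose total size is at most \<open>2 \<rho> / 5\<close>; its middle cut is at most
  \<open>8 (\<rho> / 5)\<^sup>2 / 2 powr t\<close>.  The first layer alone has mass at least \<open>\<rho>\<^sup>2 / n\<close>, and division by it
  leaves \<open>(8 / 25) n / 2 powr t\<close>.
\<close>

section \<open>Rayleigh quotients of symmetric weights\<close>

definition quad :: "'a set \<Rightarrow> ('a \<Rightarrow> 'a \<Rightarrow> real) \<Rightarrow> ('a \<Rightarrow> real) \<Rightarrow> real" where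
  "quad V a f = (\<Sum>u\<in>V. \<Sum>w\<in>V. a u w * f u * f w)"

lemma compact_box_functions:
  "compact {f :: 'a \<Rightarrow> real. (\<forall>u\<in>V. \<bar>f u\<bar> \<le> 1) \<and> (\<forall>u. u \<notin> V \<longrightarrow> f u = 0)}"
proof -
  have eq: "{f :: 'a \<Rightarrow> real. (\<forall>u\<in>V. \<bar>f u\<bar> \<le> 1) \<and> (\<forall>u. u \<notin> V \<longrightarrow> f u = 0)}
      = PiE UNIV (\<lambda>u. if u \<in> V then {-1..1} else {0})"
    by (auto simp: PiE_def Pi_def abs_le_iff split: if_splits)
  have "compactin (product_topology (\<lambda>_. euclidean) UNIV) (PiE UNIV (\<lambda>u::'a. if u \<in> V then {-1..1::real} else {0}))"
    by (subst compactin_PiE) auto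
  then show ?thesis
    unfolding eq by (simp add: euclidean_product_topology)
qed

lemma quad_scale: "quad V a (\<lambda>u. c * f u) = c\<^sup>2 * quad V a f"
  by (simp add: quad_def sum_distrib_left power2_eq_square mult_ac)

lemma quad_cong: "(\<And>u. u \<in> V \<Longrightarrow> f u = g u) \<Longrightarrow> quad V a f = quad V a g"
  by (simp add: quad_def)

text \<open>
  A maximiser of the Rayleigh quotient is a critical point.  Moving from \<open>f\<close> along the residual
  \<open>d = a f - M f\<close> by a step \<open>s\<close> changes \<open>quad - M * norm\<^sup>2\<close> by \<open>2 s \<parallel>d\<parallel>\<^sup>2\<close> up to order \<open>s\<^sup>2\<close>, which
  would be positive for a small \<open>s > 0\<close> unless \<open>d = 0\<close>.
\<close>

lemma quad_le_imp_eigenfunction: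
  fixes a :: "'a \<Rightarrow> 'a \<Rightarrow> real"
  assumes sym: "\<And>u w. u \<in> V \<Longrightarrow> w \<in> V \<Longrightarrow> a u w = a w u"
    and le: "\<And>g. quad V a g \<le> M * (\<Sum>u\<in>V. (g u)\<^sup>2)"
    and eq: "quad V a f = M * (\<Sum>u\<in>V. (f u)\<^sup>2)"
    and fin: "finite V" and u: "u \<in> V"
  shows "(\<Sum>w\<in>V. a u w * f w) = M * f u"
proof -
  define d where "d = (\<lambda>u. (\<Sum>w\<in>V. a u w * f w) - M * f u)"
  define D where "D = (\<Sum>u\<in>V. (d u)\<^sup>2)"
  define K where "K = M * (\<Sum>u\<in>V. (d u)\<^sup>2) - quad V a d"
  have cross: "(\<Sum>u\<in>V. \<Sum>w\<in>V. a u w * d u * f w) = (\<Sum>u\<in>V. \<Sum>w\<in>V. a u w * f u * d w)"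
    by (subst sum.swap) (auto intro!: sum.cong simp: sym mult_ac)
  have D: "D = (\<Sum>u\<in>V. \<Sum>w\<in>V. a u w * d u * f w) - M * (\<Sum>u\<in>V. f u * d u)"
  proof -
    have "D = (\<Sum>u\<in>V. d u * ((\<Sum>w\<in>V. a u w * f w) - M * f u))"
      unfolding D_def by (auto simp: d_def power2_eq_square)
    then show ?thesis
      by (simp add: right_diff_distrib sum_subtractf sum_distrib_left mult_ac)
  qed
  have ineq: "2 * s * D \<le> s\<^sup>2 * K" for s
  proof -
    have "quad V a (\<lambda>u. f u + s * d u) = quad V a f + s * (\<Sum>u\<in>V. \<Sum>w\<in>V. a u w * d u * f w)
        + s * (\<Sum>u\<in>V. \<Sum>w\<in>V. a u w * f u * d w) + s\<^sup>2 * quad V a d"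
      unfolding quad_def
      by (simp add: sum.distrib sum_distrib_left algebra_simps power2_eq_square)
    moreover have "(\<Sum>u\<in>V. (f u + s * d u)\<^sup>2)
        = (\<Sum>u\<in>V. (f u)\<^sup>2) + 2 * s * (\<Sum>u\<in>V. f u * d u) + s\<^sup>2 * (\<Sum>u\<in>V. (d u)\<^sup>2)"
      by (simp add: sum.distrib sum_distrib_left algebra_simps power2_eq_square)
    ultimately show ?thesis
      using le[of "\<lambda>u. f u + s * d u"] eq cross D unfolding K_def
      by (simp add: distrib_left right_diff_distrib mult_ac)
  qed
  have "D \<ge> 0" unfolding D_def by (simp add: sum_nonneg)
  have "D = 0"
  proof (rule ccontr)
    assume "D \<noteq> 0"
    with \<open>D \<ge> 0\<close> have "D > 0" by simp
    define s where "s = D / (\<bar>K\<bar> + 1)"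
    have "s > 0" using \<open>D > 0\<close> by (simp add: s_def)
    have "2 * D \<le> s * K"
      using ineq[of s] \<open>s > 0\<close> by (simp add: power2_eq_square)
    also have "s * K \<le> s * (\<bar>K\<bar> + 1)" using \<open>s > 0\<close> by simp
    also have "\<dots> = D" by (simp add: s_def)
    finally show False using \<open>D > 0\<close> by simp
  qed
  then have "d u = 0"
    unfolding D_def using fin u by (simp add: sum_nonneg_eq_0_iff)
  then show ?thesis by (simp add: d_def)
qed

text \<open>
  The unit sphere of functions on \<open>V\<close> that vanish outside \<open>V\<close> is compact in the product topology,
  by Tychonoff's theorem, so the quadratic form attains a maximum on it.
\<close>

lemma rayleigh_maximum:
  fixes a :: "'a \<Rightarrow> 'a \<Rightarrow> real"
  assumes fin: "finite V" and ne: "V \<noteq> {}"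
    and sym: "\<And>u w. u \<in> V \<Longrightarrow> w \<in> V \<Longrightarrow> a u w = a w u"
  shows "\<exists>M f. (\<exists>u\<in>V. f u \<noteq> 0) \<and> (\<forall>u\<in>V. (\<Sum>w\<in>V. a u w * f w) = M * f u) \<and>
    (\<forall>g. quad V a g \<le> M * (\<Sum>u\<in>V. (g u)\<^sup>2))"
proof -
  define B where "B = {f :: 'a \<Rightarrow> real. (\<forall>u\<in>V. \<bar>f u\<bar> \<le> 1) \<and> (\<forall>u. u \<notin> V \<longrightarrow> f u = 0)}"
  define S where "S = B \<inter> {f. (\<Sum>u\<in>V. (f u)\<^sup>2) \<in> {1}}"
  have coord: "continuous_on UNIV (\<lambda>f :: 'a \<Rightarrow> real. f u)" for u by simp
  have cont: "continuous_on UNIV (\<lambda>f :: 'a \<Rightarrow> real. \<Sum>u\<in>V. (f u)\<^sup>2)"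
    by (intro continuous_intros coord)
  have contq: "continuous_on UNIV (quad V a)"
    unfolding quad_def by (intro continuous_intros coord)
  have "closed {f :: 'a \<Rightarrow> real. (\<Sum>u\<in>V. (f u)\<^sup>2) \<in> {1}}"
    using closed_vimage[OF closed_singleton cont] 
    by (simp add: vimage_def)
  then have "compact S"
    unfolding S_def B_def using compact_box_functions by (intro compact_Int_closed)
  moreover have "S \<noteq> {}"
  proof -
    obtain v where "v \<in> V" using ne by auto
    moreover have "(\<Sum>u\<in>V. (if u = v then 1 else 0 :: real)\<^sup>2) = (\<Sum>u\<in>V. if u = v then 1 else 0)"
      by (intro sum.cong) auto
    ultimately have "(\<lambda>u. if u = v then 1 else 0) \<in> S"
      using fin by (auto simp: S_def B_def)
    then show ?thesis by auto
  qed
  ultimately obtain f where f: "f \<in> S" and max: "\<And>g. g \<in> S \<Longrightarrow> quad V a g \<le> quad V a f"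
    using continuous_attains_sup[of S "quad V a"] continuous_on_subset[OF contq] by blast
  define M where "M = quad V a f"
  have f1: "(\<Sum>u\<in>V. (f u)\<^sup>2) = 1" using f by (simp add: S_def)
  have le: "quad V a g \<le> M * (\<Sum>u\<in>V. (g u)\<^sup>2)" for g
  proof (cases "(\<Sum>u\<in>V. (g u)\<^sup>2) = 0")
    case True
    then have "\<And>u. u \<in> V \<Longrightarrow> g u = 0" using fin by (simp add: sum_nonneg_eq_0_iff)
    then show ?thesis using True by (simp add: quad_def)
  next
    case False
    define N where "N = (\<Sum>u\<in>V. (g u)\<^sup>2)"
    have "N > 0" using False by (simp add: N_def less_le sum_nonneg)
    define h where "h = (\<lambda>u. if u \<in> V then g u / sqrt N else 0)"
    have sq: "(h u)\<^sup>2 = (g u)\<^sup>2 / N" if "u \<in> V" for u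
      using \<open>N > 0\<close> that by (simp add: h_def power_divide)
    have h1: "(\<Sum>u\<in>V. (h u)\<^sup>2) = 1"
      using \<open>N > 0\<close> by (simp add: sq sum_divide_distrib[symmetric] N_def[symmetric])
    have "\<bar>h u\<bar> \<le> 1" if "u \<in> V" for u
    proof -
      have "(h u)\<^sup>2 \<le> (\<Sum>u\<in>V. (h u)\<^sup>2)" using that fin by (intro member_le_sum) auto
      then show ?thesis using h1 by (simp add: abs_square_le_1)
    qed
    then have "h \<in> S" using h1 by (auto simp: S_def B_def h_def)
    from max[OF this] have "quad V a h \<le> M" by (simp add: M_def)
    moreover have "quad V a h = quad V a (\<lambda>u. (1 / sqrt N) * g u)"
      by (rule quad_cong) (simp add: h_def)
    ultimately have "quad V a g / N \<le> M"
      using \<open>N > 0\<close> quad_scale[of V a "1 / sqrt N" g] by (simp add: power_divide)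
    then show ?thesis using \<open>N > 0\<close> by (simp add: N_def[symmetric] field_simps)
  qed
  show ?thesis
  proof (intro exI[of _ M] exI[of _ f] conjI allI)
    show "\<exists>u\<in>V. f u \<noteq> 0" using f1 by (rule contrapos_pp) auto
    show "\<forall>u\<in>V. (\<Sum>w\<in>V. a u w * f w) = M * f u"
      using quad_le_imp_eigenfunction[OF sym le _ fin] f1 by (auto simp: M_def)
  qed (rule le)
qed

section \<open>Extremal eigenvalues of symmetric matrices\<close>

text \<open>
  Eigenvectors indexed by positions become functions on vertices, so that all later sums
  range over vertices rather than over indices.
\<close>

lemma eigenvalue_mat_iff:
  fixes a :: "'a \<Rightarrow> 'a \<Rightarrow> 'f :: field"
  assumes "distinct vs"
  shows "eigenvalue (mat (length vs) (length vs) (\<lambda>(i, j). a (vs ! i) (vs ! j))) \<mu> \<longleftrightarrow>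
    (\<exists>f. (\<exists>u\<in>set vs. f u \<noteq> 0) \<and> (\<forall>u\<in>set vs. (\<Sum>w\<in>set vs. a u w * f w) = \<mu> * f u))"
    (is "eigenvalue ?A \<mu> \<longleftrightarrow> ?R")
proof -
  define n where "n = length vs"
  have bij: "bij_betw (\<lambda>i. vs ! i) {0..<n} (set vs)"
    using assms by (simp add: bij_betw_nth n_def atLeast0LessThan)
  have sum: "(\<Sum>w\<in>set vs. h w) = (\<Sum>j = 0..<n. h (vs ! j))" for h :: "'a \<Rightarrow> 'f"
    using sum.reindex_bij_betw[OF bij, of h] by simp
  have mv: "(?A *\<^sub>v z) $ i = (\<Sum>j = 0..<n. a (vs ! i) (vs ! j) * z $ j)"
    if "z \<in> carrier_vec n" "i < n" for z i
    using that by (simp add: n_def scalar_prod_def)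
  show ?thesis
  proof
    assume "eigenvalue ?A \<mu>"
    then obtain z where z: "z \<in> carrier_vec n" "z \<noteq> 0\<^sub>v n" "?A *\<^sub>v z = \<mu> \<cdot>\<^sub>v z"
      unfolding eigenvalue_def eigenvector_def by (auto simp: n_def)
    define f where "f = (\<lambda>u. z $ (inv_into {0..<n} (\<lambda>i. vs ! i) u))"
    have f: "f (vs ! i) = z $ i" if "i < n" for i
      unfolding f_def using bij_betw_inv_into_left[OF bij, of i] that by simp
    obtain i where "i < n" "z $ i \<noteq> 0"
      using z(1,2) eq_vecI[of z "0\<^sub>v n"] by auto
    then have "\<exists>u\<in>set vs. f u \<noteq> 0" using f[of i] by (auto simp: n_def intro!: bexI[of _ "vs ! i"])
    moreover have "(\<Sum>w\<in>set vs. a u w * f w) = \<mu> * f u" if u: "u \<in> set vs" for u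
    proof -
      obtain i where i: "i < n" "u = vs ! i" using u by (metis in_set_conv_nth n_def)
      have "(\<Sum>w\<in>set vs. a u w * f w) = (?A *\<^sub>v z) $ i"
        unfolding sum mv[OF z(1) i(1)] using i f by simp
      also have "\<dots> = \<mu> * f u" using z i f by simp
      finally show ?thesis .
    qed
    ultimately show ?R by blast
  next
    assume ?R
    then obtain f where f: "\<exists>u\<in>set vs. f u \<noteq> 0"
      "\<forall>u\<in>set vs. (\<Sum>w\<in>set vs. a u w * f w) = \<mu> * f u" by blast
    define z where "z = vec n (\<lambda>i. f (vs ! i))"
    have "z \<in> carrier_vec n" by (simp add: z_def)
    moreover have "z \<noteq> 0\<^sub>v n"
    proof
      assume "z = 0\<^sub>v n"
      then have "f (vs ! i) = 0" if "i < n" for i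
        using that index_vec[of i n "\<lambda>i. f (vs ! i)"] by (simp add: z_def)
      then show False using f(1) by (auto simp: in_set_conv_nth n_def)
    qed
    moreover have "?A *\<^sub>v z = \<mu> \<cdot>\<^sub>v z"
    proof (rule eq_vecI)
      fix i assume "i < dim_vec (\<mu> \<cdot>\<^sub>v z)"
      then have i: "i < n" by (simp add: z_def)
      then have "(?A *\<^sub>v z) $ i = (\<Sum>w\<in>set vs. a (vs ! i) w * f w)"
        unfolding sum using mv[of z i] by (simp add: z_def)
      also have "\<dots> = (\<mu> \<cdot>\<^sub>v z) $ i" using f(2) i by (simp add: z_def n_def)
      finally show "(?A *\<^sub>v z) $ i = (\<mu> \<cdot>\<^sub>v z) $ i" .
    qed (simp add: z_def n_def)
    ultimately show "eigenvalue ?A \<mu>"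
      unfolding eigenvalue_def eigenvector_def by (auto simp: n_def)
  qed
qed

lemma size_proots_if_complex_roots_real:
  fixes p :: "real poly"
  assumes "p \<noteq> 0" and "\<And>z :: complex. poly (map_poly of_real p) z = 0 \<Longrightarrow> z \<in> \<real>"
  shows "size (proots p) = degree p"
  using assms
proof (induction "degree p" arbitrary: p rule: less_induct)
  case less
  show ?case
  proof (cases "degree p = 0")
    case True
    then show ?thesis using size_proots_le[of p] by simp
  next
    case False
    then have "\<not> constant (poly (map_poly of_real p :: complex poly))"
      by (simp add: constant_degree)
    then obtain z :: complex where z: "poly (map_poly of_real p) z = 0"
      using fundamental_theorem_of_algebra by blast
    then obtain r where r: "z = of_real r" using less.prems(2) by (auto elim: Reals_cases)
    then have "poly p r = 0" using z by simp
    then obtain q where q: "p = [:- r, 1:] * q" by (auto simp: poly_eq_0_iff_dvd)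
    then have "q \<noteq> 0" using less.prems(1) by auto
    have hom: "map_poly of_real p = (map_poly of_real [:- r, 1:] * map_poly of_real q :: complex poly)"
    proof -
      interpret map_poly_comm_ring_hom "of_real :: real \<Rightarrow> complex" ..
      show ?thesis unfolding q by (rule hom_mult)
    qed
    have deg: "degree p = Suc (degree q)" 
      unfolding q using \<open>q \<noteq> 0\<close> by (subst degree_mult_eq) auto
    then have "size (proots q) = degree q"
      using less.prems(2) hom \<open>q \<noteq> 0\<close> by (intro less.hyps) auto
    moreover have "proots p = proots [:- r, 1:] + proots q"
      unfolding q using \<open>q \<noteq> 0\<close> by (intro proots_mult) auto
    ultimately show ?thesis using deg by (simp only: proots_linear_factor size_union) simp
  qed
qed

lemma symmetric_complex_eigenvalue_real:
  fixes a :: "'a \<Rightarrow> 'a \<Rightarrow> real" and f :: "'a \<Rightarrow> complex"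
  assumes fin: "finite V" and sym: "\<And>u w. u \<in> V \<Longrightarrow> w \<in> V \<Longrightarrow> a u w = a w u"
    and eig: "\<forall>u\<in>V. (\<Sum>w\<in>V. of_real (a u w) * f w) = \<mu> * f u"
    and nz: "\<exists>u\<in>V. f u \<noteq> 0"
  shows "\<mu> \<in> \<real>"
proof -
  define X where "X = (\<Sum>u\<in>V. \<Sum>w\<in>V. of_real (a u w) * cnj (f u) * f w)"
  define N where "N = (\<Sum>u\<in>V. (cmod (f u))\<^sup>2)"
  have "X = (\<Sum>u\<in>V. cnj (f u) * (\<Sum>w\<in>V. of_real (a u w) * f w))"
    by (simp add: X_def sum_distrib_left mult_ac)
  also have "\<dots> = (\<Sum>u\<in>V. \<mu> * of_real ((cmod (f u))\<^sup>2))"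
  proof (intro sum.cong refl)
    fix u assume "u \<in> V"
    then show "cnj (f u) * (\<Sum>w\<in>V. of_real (a u w) * f w) = \<mu> * of_real ((cmod (f u))\<^sup>2)"
      using eig unfolding complex_norm_square by simp
  qed
  finally have X: "X = \<mu> * of_real N" by (simp add: N_def sum_distrib_left)
  have "cnj X = (\<Sum>u\<in>V. \<Sum>w\<in>V. of_real (a u w) * f u * cnj (f w))"
    by (simp add: X_def)
  also have "\<dots> = X"
    unfolding X_def by (subst sum.swap) (auto intro!: sum.cong simp: sym mult_ac)
  finally have "cnj \<mu> * of_real N = \<mu> * of_real N" unfolding X by simp
  moreover have "N \<noteq> 0"
    unfolding N_def using fin nz by (subst sum_nonneg_eq_0_iff) auto
  ultimately show ?thesis by (simp add: Reals_cnj_iff)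
qed

text \<open>
  That \<open>eig A n\<close> is the smallest eigenvalue, and not an index beyond the list of real roots, rests
  on this count.  It holds because every complex eigenvalue of a real symmetric matrix is real.
\<close>

lemma size_proots_symmetric_mat:
  fixes a :: "'a \<Rightarrow> 'a \<Rightarrow> real"
  assumes dist: "distinct vs"
    and sym: "\<And>u w. u \<in> set vs \<Longrightarrow> w \<in> set vs \<Longrightarrow> a u w = a w u"
  defines "A \<equiv> mat (length vs) (length vs) (\<lambda>(i, j). a (vs ! i) (vs ! j))"
  shows "size (proots (char_poly A)) = length vs"
proof -
  have A: "A \<in> carrier_mat (length vs) (length vs)" by (simp add: A_def)
  have A': "map_mat of_real A = mat (length vs) (length vs) (\<lambda>(i, j). complex_of_real (a (vs ! i) (vs ! j)))"
    by (rule eq_matI) (simp_all add: A_def)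
  have real: "z \<in> \<real>" if "poly (map_poly of_real (char_poly A)) z = 0" for z :: complex
  proof -
    have "eigenvalue (map_mat of_real A) z"
      using that A by (subst eigenvalue_root_char_poly) (auto simp: of_real_hom.char_poly_hom)
    then obtain f where "\<exists>u\<in>set vs. f u \<noteq> 0"
      and "\<forall>u\<in>set vs. (\<Sum>w\<in>set vs. complex_of_real (a u w) * f w) = z * f u"
      unfolding A' eigenvalue_mat_iff[OF dist, of "\<lambda>u w. complex_of_real (a u w)"] by blast
    then show ?thesis
      by (intro symmetric_complex_eigenvalue_real[of "set vs" a f z]) (auto simp: sym)
  qed
  have "char_poly A \<noteq> 0" using degree_monic_char_poly[OF A] by auto
  from size_proots_if_complex_roots_real[OF this real] show ?thesis
    using degree_monic_char_poly[OF A] by simp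
qed

lemma eig_extremal:
  assumes A: "A \<in> carrier_mat n n" and "n \<ge> 1" and size: "size (proots (char_poly A)) = n"
  shows "eigenvalue A (eig A 1)"
    and "eigenvalue A \<mu> \<Longrightarrow> \<mu> \<le> eig A 1"
    and "eigenvalue A \<mu> \<Longrightarrow> eig A n \<le> \<mu>"
proof -
  define xs where "xs = sorted_list_of_multiset (proots (char_poly A))"
  have "sorted xs" by (simp add: xs_def)
  have len: "length xs = n" 
    using size size_mset[of xs] by (simp add: xs_def)
  have "char_poly A \<noteq> 0" using degree_monic_char_poly[OF A] by auto
  then have set: "set xs = {\<mu>. eigenvalue A \<mu>}"
    unfolding xs_def eigenvalue_root_char_poly[OF A] by simp
  have first: "eig A 1 = xs ! (n - 1)"
    using len \<open>n \<ge> 1\<close> by (simp add: eig_def xs_def[symmetric] rev_nth)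
  have last: "eig A n = xs ! 0"
    using len \<open>n \<ge> 1\<close> by (simp add: eig_def xs_def[symmetric] rev_nth)
  show "eigenvalue A (eig A 1)"
    using set len \<open>n \<ge> 1\<close> nth_mem[of "n - 1" xs] unfolding first by auto
  assume "eigenvalue A \<mu>"
  then obtain i where "i < n" "\<mu> = xs ! i" 
    using set len in_set_conv_nth[of \<mu> xs] by blast
  then show "\<mu> \<le> eig A 1" "eig A n \<le> \<mu>"
    unfolding first last using \<open>sorted xs\<close> len sorted_nth_mono[of xs i "n - 1"] sorted_nth_mono[of xs 0 i] by auto
qed

text \<open>
  The part of the Perron-Frobenius theorem that survives without connectedness: replacing an
  eigenfunction of the largest eigenvalue by its absolute value cannot decrease the Rayleigh
  quotient, so the absolute value is again a maximiser and hence an eigenfunction.  The second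
  claim applies the existence of a maximiser to the negated weights.
\<close>

lemma perron_and_min_rayleigh:
  fixes a :: "'a \<Rightarrow> 'a \<Rightarrow> real"
  assumes dist: "distinct vs" and ne: "vs \<noteq> []"
    and sym: "\<And>u w. u \<in> set vs \<Longrightarrow> w \<in> set vs \<Longrightarrow> a u w = a w u"
    and nonneg: "\<And>u w. u \<in> set vs \<Longrightarrow> w \<in> set vs \<Longrightarrow> a u w \<ge> 0"
  defines "A \<equiv> mat (length vs) (length vs) (\<lambda>(i, j). a (vs ! i) (vs ! j))"
  shows "\<exists>v\<in>set vs. \<exists>x. x v = 1 \<and> (\<forall>u\<in>set vs. 0 \<le> x u \<and> x u \<le> 1) \<and>
      (\<forall>u\<in>set vs. (\<Sum>w\<in>set vs. a u w * x w) = eig A 1 * x u)"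
    and "eig A (length vs) * (\<Sum>u\<in>set vs. (g u)\<^sup>2) \<le> quad (set vs) a g"
proof -
  have A: "A \<in> carrier_mat (length vs) (length vs)" by (simp add: A_def)
  have len: "length vs \<ge> 1" using ne by (cases vs) auto
  note ext = eig_extremal[OF A len size_proots_symmetric_mat[of vs a, OF dist sym, folded A_def]]
  note ev = eigenvalue_mat_iff[OF dist, of a, folded A_def]
  have fin: "finite (set vs)" and ne': "set vs \<noteq> {}" using ne by auto
  obtain M f where f: "\<exists>u\<in>set vs. f u \<noteq> 0" "\<forall>u\<in>set vs. (\<Sum>w\<in>set vs. a u w * f w) = M * f u"
    and max: "\<And>g. quad (set vs) a g \<le> M * (\<Sum>u\<in>set vs. (g u)\<^sup>2)"
    using rayleigh_maximum[of "set vs" a] fin ne' sym by blast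
  have "eigenvalue A M" using f unfolding ev by blast
  then have M: "M \<le> eig A 1" using ext(2) by blast
  have sym': "- a u w = - a w u" if "u \<in> set vs" "w \<in> set vs" for u w
    using sym[OF that] by simp
  obtain M' f' where f': "\<exists>u\<in>set vs. f' u \<noteq> 0" "\<forall>u\<in>set vs. (\<Sum>w\<in>set vs. (- a u w) * f' w) = M' * f' u"
    and max': "\<And>g. quad (set vs) (\<lambda>u w. - a u w) g \<le> M' * (\<Sum>u\<in>set vs. (g u)\<^sup>2)"
    using rayleigh_maximum[of "set vs" "\<lambda>u w. - a u w"] fin ne' sym' by blast
  have "eigenvalue A (- M')"
    unfolding ev using f' by (intro exI[of _ f']) (auto simp: sum_negf)
  then have M': "eig A (length vs) \<le> - M'" using ext(3) by blast
  show "eig A (length vs) * (\<Sum>u\<in>set vs. (g u)\<^sup>2) \<le> quad (set vs) a g"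
  proof -
    have "eig A (length vs) * (\<Sum>u\<in>set vs. (g u)\<^sup>2) \<le> - M' * (\<Sum>u\<in>set vs. (g u)\<^sup>2)"
      using M' by (intro mult_right_mono sum_nonneg) auto
    also have "\<dots> \<le> quad (set vs) a g" using max'[of g] by (simp add: quad_def sum_negf)
    finally show ?thesis .
  qed
  obtain z where z: "\<exists>u\<in>set vs. z u \<noteq> 0"
    "\<forall>u\<in>set vs. (\<Sum>w\<in>set vs. a u w * z w) = eig A 1 * z u"
    using ext(1) unfolding ev by blast
  define y where "y = (\<lambda>u. \<bar>z u\<bar>)"
  have "eig A 1 * (\<Sum>u\<in>set vs. (z u)\<^sup>2) = (\<Sum>u\<in>set vs. z u * (\<Sum>w\<in>set vs. a u w * z w))"
    using z(2) by (simp add: sum_distrib_left power2_eq_square mult_ac)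
  also have "\<dots> = quad (set vs) a z"
    by (simp add: quad_def sum_distrib_left mult_ac)
  also have "\<dots> \<le> quad (set vs) a y"
    unfolding quad_def y_def
  proof (intro sum_mono)
    fix u w assume "u \<in> set vs" "w \<in> set vs"
    then show "a u w * z u * z w \<le> a u w * \<bar>z u\<bar> * \<bar>z w\<bar>"
      using nonneg[of u w] abs_ge_self[of "z u * z w"] by (simp add: mult.assoc abs_mult mult_left_mono)
  qed
  finally have y: "eig A 1 * (\<Sum>u\<in>set vs. (y u)\<^sup>2) \<le> quad (set vs) a y" by (simp add: y_def)
  have pos: "(\<Sum>u\<in>set vs. (y u)\<^sup>2) > 0"
    using z(1) by (auto simp: y_def intro!: sum_pos2)
  have "eig A 1 * (\<Sum>u\<in>set vs. (y u)\<^sup>2) \<le> M * (\<Sum>u\<in>set vs. (y u)\<^sup>2)" using y max[of y] by simp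
  then have M_eq: "M = eig A 1" using M pos by simp
  have eig_y: "(\<Sum>w\<in>set vs. a u w * y w) = eig A 1 * y u" if "u \<in> set vs" for u
  proof (rule quad_le_imp_eigenfunction[of "set vs" a, OF sym])
    show "quad (set vs) a g \<le> eig A 1 * (\<Sum>u\<in>set vs. (g u)\<^sup>2)" for g
      using max[of g] M_eq by simp
    then show "quad (set vs) a y = eig A 1 * (\<Sum>u\<in>set vs. (y u)\<^sup>2)"
      using y by (simp add: antisym)
  qed (use that in auto)
  define m where "m = Max (y ` set vs)"
  have "m \<in> y ` set vs" unfolding m_def using ne' by (intro Max_in) auto
  then obtain v where v: "v \<in> set vs" "y v = m" by auto
  have le: "y u \<le> m" if "u \<in> set vs" for u unfolding m_def using that by (intro Max_ge) auto
  have "m > 0" using z(1) le unfolding y_def by (metis less_le_trans zero_less_abs_iff)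
  show "\<exists>v\<in>set vs. \<exists>x. x v = 1 \<and> (\<forall>u\<in>set vs. 0 \<le> x u \<and> x u \<le> 1) \<and>
      (\<forall>u\<in>set vs. (\<Sum>w\<in>set vs. a u w * x w) = eig A 1 * x u)"
  proof (intro bexI[of _ v] exI[of _ "\<lambda>u. y u / m"] conjI ballI)
    fix u assume u: "u \<in> set vs"
    show "0 \<le> y u / m" "y u / m \<le> 1" using le[OF u] \<open>m > 0\<close> by (simp_all add: y_def)
    show "(\<Sum>w\<in>set vs. a u w * (y w / m)) = eig A 1 * (y u / m)"
      using eig_y[OF u] by (simp add: sum_divide_distrib[symmetric])
  qed (use v \<open>m > 0\<close> in auto)
qed

section \<open>Odd closed walks and distance layers\<close>

text \<open>
  If a vertex repeats, the walk splits into two shorter closed walks, and one of them has odd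
  length.
\<close>

lemma (in wf_digraph) odd_closed_walk_imp_odd_cycle:
  assumes "awalk u p u" and "odd (length p)"
  shows "\<exists>c. cycle c \<and> odd (length c) \<and> length c \<le> length p"
  using assms
proof (induction "length p" arbitrary: u p rule: less_induct)
  case less
  have "p \<noteq> []" using less.prems(2) by auto
  have cas: "cas u p u" using less.prems(1) by auto
  show ?case
  proof (cases "distinct (tl (awalk_verts u p))")
    case True
    then show ?thesis using less.prems \<open>p \<noteq> []\<close> by (auto simp: cycle_def)
  next
    case False
    then have "\<not> distinct (map (head G) p)"
      using awalk_verts_conv'[OF cas] \<open>p \<noteq> []\<close> by simp
    then obtain xs y ys zs where dec: "map (head G) p = (xs @ [y]) @ (ys @ [y]) @ zs"
      using not_distinct_decomp[of "map (head G) p"] by auto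
    obtain q p' where p': "p = q @ p'" and q: "map (head G) q = xs @ [y]"
      and q': "map (head G) p' = (ys @ [y]) @ zs"
      using map_eq_append_conv[THEN iffD1, OF dec] by metis
    obtain r s where "p' = r @ s" and r: "map (head G) r = ys @ [y]"
      using map_eq_append_conv[THEN iffD1, OF q'] by metis
    then have p: "p = q @ r @ s" using p' by simp
    have nonempty: "q \<noteq> []" "r \<noteq> []" using q r by auto
    have head_last: "head G (last q) = y" "head G (last r) = y"
      using q r nonempty by (metis last_map last_snoc)+
    have walks: "awalk u q (awlast u q)" "awalk (awlast u q) r (awlast (awlast u q) r)"
      "awalk (awlast (awlast u q) r) s u"
      using less.prems(1) unfolding p by (auto simp: awalk_append_iff)
    have "awlast u q = y" "awlast (awlast u q) r = y"
      using head_last nonempty by (simp_all add: awalk_verts_conv)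
    with walks have "awalk u q y" "awalk y r y" "awalk y s u" by simp_all
    then have qs: "awalk u (q @ s) u" and r': "awalk y r y" by auto
    have "length (q @ s) < length p" "length r < length p" using nonempty by (auto simp: p)
    moreover have "odd (length (q @ s)) \<or> odd (length r)" using less.prems(2) by (auto simp: p)
    ultimately show ?thesis
      using less.hyps[OF _ qs] less.hyps[OF _ r'] by (meson le_trans less_imp_le)
  qed
qed

lemma (in wf_digraph) awalk_of_relpow:
  assumes "(u, w) \<in> arcs_ends G ^^ i" and "u \<in> verts G"
  shows "\<exists>p. awalk u p w \<and> length p = i"
  using assms
proof (induction i arbitrary: u)
  case 0
  then show ?case by (auto simp: awalk_Nil_iff)
next
  case (Suc i)
  then obtain z where z: "(u, z) \<in> arcs_ends G" "(z, w) \<in> arcs_ends G ^^ i"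
    by (meson relpow_Suc_D2)
  then obtain e where e: "e \<in> arcs G" "tail G e = u" "head G e = z" by (auto simp: arcs_ends_conv)
  then have "z \<in> verts G" by auto
  with Suc.IH z(2) obtain p where "awalk z p w" "length p = i" by blast
  then have "awalk u (e # p) w \<and> length (e # p) = Suc i" using e by (auto simp: awalk_Cons_iff)
  then show ?case by blast
qed

text \<open>
  The vertices at distance \<open>i\<close> from \<open>v\<close>.  Relation powers record only the existence of walks of a
  given length, which makes the reversal and concatenation of walks immediate.
\<close>

definition layer :: "'a rel \<Rightarrow> 'a \<Rightarrow> nat \<Rightarrow> 'a set" where
  "layer E v i = {w. (v, w) \<in> E ^^ i \<and> (\<forall>j<i. (v, w) \<notin> E ^^ j)}"

lemma layer_0: "layer E v 0 = {v}"
  by (auto simp: layer_def)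

lemma layer_disjoint: "i \<noteq> j \<Longrightarrow> layer E v i \<inter> layer E v j = {}"
  by (auto simp: layer_def) (metis linorder_neqE_nat)

lemma relpow_sym: "sym E \<Longrightarrow> (u, w) \<in> E ^^ i \<Longrightarrow> (w, u) \<in> E ^^ i"
proof (induction i arbitrary: w)
  case (Suc i)
  then obtain z where "(u, z) \<in> E ^^ i" "(z, w) \<in> E" by auto
  with Suc show ?case by (meson relpow_Suc_I2 symD)
qed auto

lemma layer_neighbour:
  assumes "sym E" and u: "u \<in> layer E v i" and uw: "(u, w) \<in> E"
  shows "w \<in> layer E v i \<or> w \<in> layer E v (Suc i) \<or> (\<exists>j. i = Suc j \<and> w \<in> layer E v j)"
proof -
  have vu: "(v, u) \<in> E ^^ i" and min: "\<And>j. (v, u) \<in> E ^^ j \<Longrightarrow> i \<le> j"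
    using u not_le by (auto simp: layer_def)
  have vw: "(v, w) \<in> E ^^ Suc i" using vu uw by auto
  define j where "j = (LEAST j. (v, w) \<in> E ^^ j)"
  have "(v, w) \<in> E ^^ j" and "j \<le> Suc i"
    unfolding j_def using vw by (rule LeastI, rule Least_le)
  moreover have "w \<in> layer E v j"
    using \<open>(v, w) \<in> E ^^ j\<close> not_less_Least unfolding layer_def j_def by auto
  moreover have "i \<le> Suc j"
    using \<open>(v, w) \<in> E ^^ j\<close> symD[OF \<open>sym E\<close> uw] by (intro min) auto
  ultimately show ?thesis by (metis le_Suc_eq le_antisym)
qed

text \<open>
  An edge inside layer \<open>i\<close>, together with shortest walks from \<open>v\<close> to its two ends, is a closed walk
  of the odd length \<open>2 * i + 1\<close>.
\<close>

lemma layer_independent: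
  assumes "pair_graph G" and "odd_girth G \<ge> enat k" and "2 * i + 1 < k"
    and v: "v \<in> pverts G"
    and u: "u \<in> layer (parcs G) v i" and w: "w \<in> layer (parcs G) v i"
  shows "(u, w) \<notin> parcs G"
proof
  interpret pair_graph G by fact
  assume uw: "(u, w) \<in> parcs G"
  have "sym (parcs G)" using pair_sym_arcs by (simp add: symmetric_def)
  have "(v, u) \<in> parcs G ^^ i" "(w, v) \<in> parcs G ^^ i"
    using u w relpow_sym[OF \<open>sym (parcs G)\<close>] by (auto simp: layer_def)
  then have "(v, v) \<in> parcs G ^^ (Suc i + i)"
    unfolding relpow_add using uw by auto
  then obtain p where "awalk v p v" "length p = Suc i + i"
    using awalk_of_relpow[of v v "Suc i + i"] v by auto
  then obtain c where c: "cycle c" "odd (length c)" "length c \<le> Suc i + i"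
    using odd_closed_walk_imp_odd_cycle[of v p] by auto
  then have "odd_girth G \<le> enat (length c)"
    unfolding odd_girth_def by (intro INF_lower) auto
  then have "enat k \<le> enat (length c)" using assms(2) by (rule order_trans[rotated])
  with c assms(3) show False by simp
qed

section \<open>An eigenfunction on distance layers\<close>

text \<open>
  Of the distance layers only this is kept: they are disjoint, and the neighbours of a vertex
  in one of the layers \<open>0, \<dots>, R\<close> lie in the two adjacent layers.
\<close>

locale layering =
  fixes V :: "'a set" and a :: "'a \<Rightarrow> 'a \<Rightarrow> real" and x :: "'a \<Rightarrow> real" and \<rho> :: real
    and N :: "nat \<Rightarrow> 'a set" and R :: nat
  assumes fin: "finite V"
    and sym: "\<And>u w. u \<in> V \<Longrightarrow> w \<in> V \<Longrightarrow> a u w = a w u"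
    and weight: "\<And>u w. u \<in> V \<Longrightarrow> w \<in> V \<Longrightarrow> 0 \<le> a u w \<and> a u w \<le> 1"
    and x_bounds: "\<And>u. u \<in> V \<Longrightarrow> 0 \<le> x u \<and> x u \<le> 1"
    and eigen: "\<And>u. u \<in> V \<Longrightarrow> (\<Sum>w\<in>V. a u w * x w) = \<rho> * x u"
    and sub: "\<And>i. N i \<subseteq> V"
    and disj: "\<And>i j. i \<noteq> j \<Longrightarrow> N i \<inter> N j = {}"
    and consecutive: "\<And>i u w. \<lbrakk>i \<le> R; u \<in> N i; w \<in> V; a u w \<noteq> 0\<rbrakk> \<Longrightarrow>
      w \<in> N (Suc i) \<or> (\<exists>j. i = Suc j \<and> w \<in> N j)"
begin

definition mass :: "nat \<Rightarrow> real" where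
  "mass i = (\<Sum>u\<in>N i. (x u)\<^sup>2)"

definition cut :: "nat \<Rightarrow> real" where
  "cut i = (\<Sum>u\<in>N i. \<Sum>w\<in>N (Suc i). a u w * x u * x w)"

lemma fin_layer: "finite (N i)"
  using sub fin by (rule finite_subset)

lemma mem_V: "u \<in> N i \<Longrightarrow> u \<in> V"
  using sub by auto

lemma mass_nonneg: "mass i \<ge> 0"
  unfolding mass_def by (simp add: sum_nonneg)

lemma cut_nonneg: "cut i \<ge> 0"
  unfolding cut_def using weight x_bounds mem_V by (intro sum_nonneg mult_nonneg_nonneg) auto

lemma cut_flip: "(\<Sum>u\<in>N (Suc i). \<Sum>w\<in>N i. a u w * x u * x w) = cut i"
  unfolding cut_def by (subst sum.swap) (auto intro!: sum.cong simp: sym mem_V mult_ac)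

lemma eigen_mass: "\<rho> * mass i = (\<Sum>u\<in>N i. \<Sum>w\<in>V. a u w * x u * x w)"
proof -
  have "\<rho> * mass i = (\<Sum>u\<in>N i. x u * (\<rho> * x u))"
    by (simp add: mass_def sum_distrib_left power2_eq_square mult_ac)
  also have "\<dots> = (\<Sum>u\<in>N i. x u * (\<Sum>w\<in>V. a u w * x w))"
    using eigen mem_V by (intro sum.cong) auto
  finally show ?thesis by (simp add: sum_distrib_left mult_ac)
qed

lemma eigen_mass_0: "\<rho> * mass 0 = cut 0"
  unfolding eigen_mass cut_def
  using consecutive[of 0] fin sub by (intro sum.cong sum.mono_neutral_right) auto

lemma eigen_mass_Suc:
  assumes "Suc i \<le> R"
  shows "\<rho> * mass (Suc i) = cut i + cut (Suc i)"
proof -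
  have "(\<Sum>w\<in>V. a u w * x u * x w) = (\<Sum>w\<in>N i. a u w * x u * x w) + (\<Sum>w\<in>N (Suc (Suc i)). a u w * x u * x w)"
    if "u \<in> N (Suc i)" for u
  proof -
    have "(\<Sum>w\<in>V. a u w * x u * x w) = (\<Sum>w\<in>N i \<union> N (Suc (Suc i)). a u w * x u * x w)"
      using consecutive[OF assms that] sub fin by (intro sum.mono_neutral_right) auto
    then show ?thesis using disj[of i "Suc (Suc i)"] by (simp add: sum.union_disjoint fin_layer)
  qed
  then have "\<rho> * mass (Suc i) = (\<Sum>u\<in>N (Suc i). (\<Sum>w\<in>N i. a u w * x u * x w) + (\<Sum>w\<in>N (Suc (Suc i)). a u w * x u * x w))"
    unfolding eigen_mass by (intro sum.cong) auto
  then show ?thesis unfolding sum.distrib cut_flip by (simp add: cut_def)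
qed

lemma eigen_mass_partial:
  "i \<le> R \<Longrightarrow> \<rho> * (\<Sum>j\<le>i. mass j) = 2 * (\<Sum>j<i. cut j) + cut i"
proof (induction i)
  case 0
  then show ?case by (simp add: eigen_mass_0)
next
  case (Suc i)
  have "\<rho> * (\<Sum>j\<le>Suc i. mass j) = \<rho> * (\<Sum>j\<le>i. mass j) + \<rho> * mass (Suc i)"
    by (simp add: distrib_left)
  then show ?case using Suc eigen_mass_Suc[OF Suc.prems] by simp
qed

lemma cut_squared_le: "(cut i)\<^sup>2 \<le> real (card (N i) * card (N (Suc i))) * (mass i * mass (Suc i))"
proof -
  let ?P = "\<lambda>i. \<Sum>u\<in>N i. x u"
  have nonneg: "?P j \<ge> 0" for j using x_bounds mem_V by (intro sum_nonneg) auto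
  have sum_squared_le: "(?P j)\<^sup>2 \<le> real (card (N j)) * mass j" for j
    using Cauchy_Schwarz_ineq_sum[of "\<lambda>_. 1" x "N j"] by (simp add: mass_def)
  have "cut i \<le> (\<Sum>u\<in>N i. \<Sum>w\<in>N (Suc i). x u * x w)"
    unfolding cut_def
  proof (intro sum_mono)
    fix u w assume "u \<in> N i" "w \<in> N (Suc i)"
    then have "0 \<le> x u * x w" "a u w \<le> 1" using x_bounds mem_V weight by auto
    then show "a u w * x u * x w \<le> x u * x w"
      using mult_right_mono[of "a u w" 1 "x u * x w"] by (simp add: mult.assoc)
  qed
  then have "cut i \<le> ?P i * ?P (Suc i)" by (simp add: sum_product)
  then have "(cut i)\<^sup>2 \<le> (?P i * ?P (Suc i))\<^sup>2" by (rule power_mono) (rule cut_nonneg)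
  also have "\<dots> = (?P i)\<^sup>2 * (?P (Suc i))\<^sup>2" by (simp add: power_mult_distrib)
  also have "\<dots> \<le> (real (card (N i)) * mass i) * (real (card (N (Suc i))) * mass (Suc i))"
    by (intro mult_mono sum_squared_le) (auto intro: mult_nonneg_nonneg mass_nonneg)
  finally show ?thesis by (simp add: mult_ac)
qed

lemma mass_le_card: "mass i \<le> real (card (N i))"
proof -
  have "mass i \<le> (\<Sum>u\<in>N i. 1)"
    unfolding mass_def using x_bounds mem_V by (intro sum_mono) (simp add: power_le_one)
  then show ?thesis by simp
qed

lemma cut_le_card: "cut i \<le> real (card (N i)) * real (card (N (Suc i)))"
proof -
  have "(cut i)\<^sup>2 \<le> real (card (N i) * card (N (Suc i))) * (mass i * mass (Suc i))"
    by (rule cut_squared_le)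
  also have "\<dots> \<le> real (card (N i) * card (N (Suc i))) * (real (card (N i)) * real (card (N (Suc i))))"
    by (intro mult_left_mono mult_mono mass_le_card mass_nonneg) auto
  also have "\<dots> = (real (card (N i)) * real (card (N (Suc i))))\<^sup>2" by (simp add: power2_eq_square)
  finally show ?thesis by (rule power2_le_imp_le) simp
qed

lemma product_card_le:
  assumes "real (card (N i)) + real (card (N (Suc i))) \<le> 2 * \<rho> / 5"
  shows "real (card (N i)) * real (card (N (Suc i))) \<le> (\<rho> / 5)\<^sup>2"
proof -
  have "4 * (real (card (N i)) * real (card (N (Suc i)))) \<le> (real (card (N i)) + real (card (N (Suc i))))\<^sup>2"
    using zero_le_power2[of "real (card (N i)) - real (card (N (Suc i)))"] by (simp add: power2_eq_square algebra_simps)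
  also have "\<dots> \<le> (2 * \<rho> / 5)\<^sup>2" using assms by (intro power_mono) auto
  finally show ?thesis by (simp add: power2_eq_square)
qed

text \<open>
  If the middle cut \<open>c\<close> exceeded \<open>K / 4\<close>, the product \<open>(cut i + c) * (c + cut (i + 2))\<close> would be
  smaller than \<open>(5 * c)\<^sup>2\<close>, whereas the eigenvalue equations for the two layers that \<open>c\<close> joins,
  combined with the Cauchy-Schwarz bound on \<open>c\<close>, make it at least \<open>(5 * c)\<^sup>2\<close>.
\<close>

lemma cut_decay_step:
  assumes R: "Suc (Suc i) \<le> R"
    and small: "real (card (N (Suc i))) + real (card (N (Suc (Suc i)))) \<le> 2 * \<rho> / 5"
    and K: "cut i \<le> K" "cut (Suc i) \<le> K" "cut (Suc (Suc i)) \<le> K"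
  shows "cut (Suc i) \<le> K / 4"
proof (rule ccontr)
  let ?c = "cut (Suc i)"
  assume "\<not> ?thesis"
  then have lt: "K < 4 * ?c" by simp
  then have "?c > 0" using K(1) cut_nonneg[of i] by linarith
  have "25 * ?c\<^sup>2 \<le> 25 * ((\<rho> / 5)\<^sup>2 * (mass (Suc i) * mass (Suc (Suc i))))"
    using cut_squared_le[of "Suc i"] product_card_le[OF small]
      mult_right_mono[OF product_card_le[OF small], of "mass (Suc i) * mass (Suc (Suc i))"]
    by (simp add: mass_nonneg)
  also have "\<dots> = (\<rho> * mass (Suc i)) * (\<rho> * mass (Suc (Suc i)))"
    by (simp add: power2_eq_square)
  also have "\<dots> = (cut i + ?c) * (?c + cut (Suc (Suc i)))"
    using R by (simp add: eigen_mass_Suc)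
  also have "\<dots> \<le> (K + ?c) * (?c + K)"
    using K cut_nonneg by (intro mult_mono) (auto intro: add_nonneg_nonneg order_trans[OF cut_nonneg])
  also have "\<dots> < (5 * ?c) * (5 * ?c)"
    using lt \<open>?c > 0\<close> K cut_nonneg[of i] by (intro mult_strict_mono) auto
  finally show False by (simp add: power2_eq_square)
qed

text \<open>
  Each step away from the ends of the run of small layers \<open>s, \<dots>, s + L\<close> gains a factor 4.  The
  starting value \<open>|N i| * |N (i + 1)|\<close> comes from \<open>x \<le> 1\<close>; this is where the normalisation of \<open>x\<close> by
  its maximum enters.
\<close>

lemma cut_decay:
  assumes R: "s + L \<le> R"
    and small: "\<And>i. \<lbrakk>s \<le> i; i < s + L\<rbrakk> \<Longrightarrow>
      real (card (N i)) + real (card (N (Suc i))) \<le> 2 * \<rho> / 5"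
  shows "\<lbrakk>s + j \<le> i; i + j < s + L\<rbrakk> \<Longrightarrow> cut i \<le> (\<rho> / 5)\<^sup>2 / 4 ^ j"
proof (induction j arbitrary: i)
  case 0
  then show ?case using cut_le_card[of i] product_card_le[OF small[of i]] by simp
next
  case (Suc j)
  then obtain k where k: "i = Suc k" by (cases i) auto
  have "cut (Suc k) \<le> (\<rho> / 5)\<^sup>2 / 4 ^ j / 4"
    using Suc.prems R unfolding k by (intro cut_decay_step Suc.IH small) auto
  then show ?case by (simp add: k)
qed

text \<open>
  Since every edge inside the ball joins layers of opposite sign, the alternating signs turn each
  edge weight of the ball into its negative; each edge is counted once from either end.
\<close>

lemma alternating_quad:
  assumes "i \<le> R"
  defines "g \<equiv> (\<lambda>u. \<Sum>j\<le>i. if u \<in> N j then (-1) ^ j * x u else 0)"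
  shows "(\<Sum>u\<in>V. (g u)\<^sup>2) = (\<Sum>j\<le>i. mass j)"
    and "quad V a g = - 2 * (\<Sum>j<i. cut j)"
proof -
  have g: "g u = (-1) ^ j * x u" if "u \<in> N j" "j \<le> i" for u j
  proof -
    have "g u = (\<Sum>k\<le>i. if k = j then (-1) ^ j * x u else 0)"
      unfolding g_def using that disj by (intro sum.cong) auto
    then show ?thesis using that by simp
  qed
  have g0: "g u = 0" if "u \<notin> (\<Union>j\<le>i. N j)" for u
    using that unfolding g_def by (intro sum.neutral) auto
  have ball: "(\<Sum>u\<in>V. h u) = (\<Sum>j\<le>i. \<Sum>u\<in>N j. h u)" if "\<And>u. g u = 0 \<Longrightarrow> h u = 0" for h :: "'a \<Rightarrow> real"
  proof -
    have "(\<Sum>u\<in>V. h u) = (\<Sum>u\<in>(\<Union>j\<le>i. N j). h u)"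
      using fin sub g0 that by (intro sum.mono_neutral_right) auto
    also have "\<dots> = (\<Sum>j\<le>i. \<Sum>u\<in>N j. h u)"
      using fin_layer disj by (intro sum.UNION_disjoint) auto
    finally show ?thesis .
  qed
  have "(\<Sum>u\<in>V. (g u)\<^sup>2) = (\<Sum>j\<le>i. \<Sum>u\<in>N j. (g u)\<^sup>2)"
    by (rule ball) simp
  also have "\<dots> = (\<Sum>j\<le>i. mass j)"
    unfolding mass_def using g by (intro sum.cong) (auto simp: power_mult_distrib simp flip: power_mult)
  finally show "(\<Sum>u\<in>V. (g u)\<^sup>2) = (\<Sum>j\<le>i. mass j)" .
  have row: "(\<Sum>w\<in>V. a u w * g w) = (-1) ^ Suc j *
      ((\<Sum>w\<in>V. a u w * x w) - (if j = i then \<Sum>w\<in>N (Suc j). a u w * x w else 0))"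
    if uj: "u \<in> N j" and ji: "j \<le> i" for u j
  proof -
    have jR: "j \<le> R" using ji assms by simp
    \<comment> \<open>On the boundary layer \<open>j = i\<close> the outer neighbours lie outside the ball and drop out.\<close>
    have "(\<Sum>w\<in>V. a u w * g w) = (\<Sum>w\<in>V. (-1) ^ Suc j *
        (a u w * x w - (if j = i \<and> w \<in> N (Suc j) then a u w * x w else 0)))"
    proof (intro sum.cong refl)
      fix w assume w: "w \<in> V"
      have "w \<notin> N (Suc j)" if "j = Suc k" "w \<in> N k" for k
        using that disj[of k "Suc j"] by auto
      then consider "a u w = 0" "w \<notin> N (Suc j)" | "a u w = 0" "w \<in> N (Suc j)" | "w \<in> N (Suc j)" "j < i"
        | "w \<in> N (Suc j)" "j = i" | k where "j = Suc k" "w \<in> N k" "w \<notin> N (Suc j)"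
        using consecutive[OF jR uj w] ji by (meson le_neq_implies_less)
      then show "a u w * g w = (-1) ^ Suc j * (a u w * x w - (if j = i \<and> w \<in> N (Suc j) then a u w * x w else 0))"
      proof cases
        case 4
        then have "w \<notin> N k" if "k \<le> i" for k using disj[of k "Suc i"] that by auto
        then have "w \<notin> (\<Union>j\<le>i. N j)" by auto
        then show ?thesis using 4 g0 by simp
      qed (use ji g in auto)
    qed
    also have "\<dots> = (-1) ^ Suc j * (\<Sum>w\<in>V. a u w * x w - (if j = i \<and> w \<in> N (Suc j) then a u w * x w else 0))"
      by (simp only: sum_distrib_left)
    also have "(\<Sum>w\<in>V. a u w * x w - (if j = i \<and> w \<in> N (Suc j) then a u w * x w else 0))
        = (\<Sum>w\<in>V. a u w * x w) - (if j = i then \<Sum>w\<in>N (Suc j). a u w * x w else 0)"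
      using sub[of "Suc j"] fin by (auto simp: sum_subtractf sum.If_cases Int_absorb1)
    finally show ?thesis .
  qed
  have "quad V a g = (\<Sum>u\<in>V. g u * (\<Sum>w\<in>V. a u w * g w))"
    by (simp add: quad_def sum_distrib_left mult_ac)
  also have "\<dots> = (\<Sum>j\<le>i. \<Sum>u\<in>N j. g u * (\<Sum>w\<in>V. a u w * g w))"
    by (rule ball) simp
  also have "\<dots> = (\<Sum>j\<le>i. - (\<rho> * mass j) + (if j = i then cut j else 0))"
  proof (intro sum.cong refl)
    fix j assume "j \<in> {..i}"
    then have j: "j \<le> i" by simp
    have "(\<Sum>u\<in>N j. g u * (\<Sum>w\<in>V. a u w * g w))
      = (\<Sum>u\<in>N j. - (x u * (\<rho> * x u)) + (if j = i then \<Sum>w\<in>N (Suc j). a u w * x u * x w else 0))"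
    proof (intro sum.cong refl)
      fix u assume u: "u \<in> N j"
      have sign: "(-1) ^ j * (-1) ^ Suc j = (-1 :: real)" by (simp flip: power_mult_distrib)
      have "g u * (\<Sum>w\<in>V. a u w * g w) = ((-1) ^ j * (-1) ^ Suc j) *
          (x u * ((\<Sum>w\<in>V. a u w * x w) - (if j = i then \<Sum>w\<in>N (Suc j). a u w * x w else 0)))"
        unfolding row[OF u j] g[OF u j] by (simp only: mult_ac)
      also have "\<dots> = - (x u * (\<rho> * x u)) + (if j = i then x u * (\<Sum>w\<in>N (Suc j). a u w * x w) else 0)"
        unfolding sign eigen[OF mem_V[OF u]] by (simp add: algebra_simps)
      finally show "g u * (\<Sum>w\<in>V. a u w * g w) = - (x u * (\<rho> * x u)) +
          (if j = i then \<Sum>w\<in>N (Suc j). a u w * x u * x w else 0)"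
        by (simp add: sum_distrib_left mult_ac)
    qed
    also have "\<dots> = - (\<rho> * mass j) + (if j = i then cut j else 0)"
      unfolding sum.distrib by (simp add: mass_def cut_def sum_negf sum_distrib_left power2_eq_square mult_ac)
    finally show "(\<Sum>u\<in>N j. g u * (\<Sum>w\<in>V. a u w * g w)) = - (\<rho> * mass j) + (if j = i then cut j else 0)" .
  qed
  also have "\<dots> = - (\<rho> * (\<Sum>j\<le>i. mass j)) + cut i"
    unfolding sum.distrib by (simp add: sum_negf sum_distrib_left)
  also have "\<dots> = - 2 * (\<Sum>j<i. cut j)"
    using eigen_mass_partial[OF assms(1)] by simp
  finally show "quad V a g = - 2 * (\<Sum>j<i. cut j)" .
qed

text \<open>
  The eigenvalue equation turns the weight of the edges inside the ball into
  \<open>\<rho> * (\<Sum>j\<le>i. mass j) - cut i\<close>; the loss \<open>cut i\<close> comes from the edges that leave the ball.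
\<close>

lemma smallest_eigenvalue_cut:
  assumes "i \<le> R" and low: "\<And>g. \<mu> * (\<Sum>u\<in>V. (g u)\<^sup>2) \<le> quad V a g"
  shows "(\<rho> + \<mu>) * (\<Sum>j\<le>i. mass j) \<le> cut i"
  using low[of "\<lambda>u. \<Sum>j\<le>i. if u \<in> N j then (-1) ^ j * x u else 0"]
    alternating_quad[OF assms(1)] eigen_mass_partial[OF assms(1)]
  by (simp add: distrib_right)

end

context layering
begin

text \<open>
  Pigeonhole over \<open>P\<close> disjoint blocks of \<open>m\<close> consecutive layers.  The blocks start at layer 1, so
  that a ball reaching into a block contains the first layer and its mass.
\<close>

lemma light_block_exists:
  assumes m: "P * m \<le> R" and P: "P > 0"
  obtains s where "1 \<le> s" and "s + m \<le> Suc R"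
    and "real P * (\<Sum>i = s..<s + m. real (card (N i))) \<le> real (card V)"
proof -
  let ?f = "\<lambda>i. card (N (Suc i))"
  let ?block = "\<lambda>b. \<Sum>i = b * m..<b * m + m. ?f i"
  have "(\<Sum>b<P. ?block b) = (\<Sum>i<P * m. ?f i)"
    by (rule sum.nat_group)
  also have "\<dots> = card (\<Union>i<P * m. N (Suc i))"
    using fin_layer disj by (intro card_UN_disjoint[symmetric]) auto
  also have "\<dots> \<le> card V"
    using fin sub by (intro card_mono) auto
  finally have total: "(\<Sum>b<P. ?block b) \<le> card V" .
  have "\<exists>b<P. P * ?block b \<le> card V"
  proof (rule ccontr)
    assume "\<not> ?thesis"
    then have "(\<Sum>b<P. card V) < (\<Sum>b<P. P * ?block b)"
      using P by (intro sum_strict_mono) (auto simp: not_le)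
    also have "\<dots> = P * (\<Sum>b<P. ?block b)" by (simp add: sum_distrib_left)
    also have "\<dots> \<le> P * card V" using total by simp
    finally show False by simp
  qed
  then obtain b where b: "b < P" "P * ?block b \<le> card V" by blast
  have shift: "?block b = (\<Sum>i = Suc (b * m)..<Suc (b * m) + m. card (N i))"
    using sum.shift_bounds_Suc_ivl[of "\<lambda>i. card (N i)" "b * m" "b * m + m"] by simp
  have "b * m + m \<le> P * m" using b(1) mult_le_mono1[of "Suc b" P m] by simp
  then show thesis
    using that[of "Suc (b * m)"] m b(2) unfolding shift by (simp flip: of_nat_sum of_nat_mult)
qed

text \<open>
  The radius is the middle of a run of \<open>\<lfloor>t\<rfloor> + 1\<close> light layers, where \<open>t = k * \<rho> / (16 * n)\<close>.  The
  lower bound on \<open>\<rho>\<close> says that \<open>t \<ge> 1\<close>, so the run contains a cut.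
\<close>

lemma eigenvalue_sum_bound:
  assumes root: "N 0 = {v}" "x v = 1" and n: "n = card V"
    and low: "\<And>g. \<mu> * (\<Sum>u\<in>V. (g u)\<^sup>2) \<le> quad V a g"
    and k: "k \<ge> 100" "k \<le> 2 * R + 3"
    and large: "\<rho> \<ge> 16 * real n / real k"
  shows "(\<rho> + \<mu>) / real n \<le> 4 * 2 powr (- (real k * \<rho> / (16 * real n)))"
proof -
  define t where "t = real k * \<rho> / (16 * real n)"
  have v: "v \<in> V" using root(1) sub[of 0] by auto
  then have n_pos: "real n > 0" using fin by (auto simp: n card_gt_0_iff)
  then have "\<rho> > 0" using k(1)
    by (intro less_le_trans[OF _ large] divide_pos_pos) auto
  have "\<rho> = (\<Sum>w\<in>V. a v w * x w)" using eigen[OF v] root(2) by simp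
  also have "\<dots> \<le> (\<Sum>w\<in>V. 1)"
    using weight v x_bounds by (intro sum_mono mult_le_one) auto
  finally have "\<rho> \<le> real n" by (simp add: n)
  have t: "t \<ge> 1" "t \<le> real k / 16"
    using large \<open>\<rho> \<le> real n\<close> n_pos k(1) by (auto simp: t_def field_simps)
  \<comment> \<open>Blocks of \<open>L + 1\<close> layers contain \<open>L\<close> cuts, enough for a decay by about \<open>2 powr t\<close>.\<close>
  define L where "L = nat \<lfloor>t\<rfloor>"
  have L: "L \<ge> 1" "real L \<le> t" "t < real L + 1" using t(1) unfolding L_def by linarith+
  define P where "P = R div Suc L"
  have PR: "P * Suc L \<le> R" unfolding P_def by (rule div_times_less_eq_dividend)
  have "R < P * Suc L + Suc L"
    unfolding P_def using dividend_less_div_times[of "Suc L" R] by simp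
  then have "R + 1 \<le> P * Suc L + Suc L" by simp
  then have "real (R + 1) \<le> real (P * Suc L + Suc L)" by (rule of_nat_mono)
  then have "real k - 1 \<le> 2 * (real P * (real L + 1)) + 2 * (real L + 1)"
    using k(2) by (simp add: algebra_simps)
  moreover have "real P * (real L + 1) \<le> real P * (2 * t)"
    using L t by (intro mult_left_mono) auto
  moreover have "real P * (2 * t) = 2 * (real P * t)" by simp
  \<comment> \<open>Because \<open>\<rho> \<le> n\<close> gives \<open>t \<le> k / 16\<close>, the rounding in the number of blocks costs little.\<close>
  ultimately have "7 * real k - 24 \<le> 32 * (real P * t)" using L(2) t(2) by argo
  then have Pt: "5 * real k \<le> 32 * (real P * t)" using k(1) by linarith
  then have "P > 0" using k(1) by (cases P) auto
  have "5 * real n \<le> 2 * \<rho> * real P"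
    using Pt n_pos k(1) by (simp add: t_def field_simps)
  obtain s where s: "1 \<le> s" "s + Suc L \<le> Suc R"
    and block: "real P * (\<Sum>i = s..<s + Suc L. real (card (N i))) \<le> real n"
    using light_block_exists[OF PR \<open>P > 0\<close>] unfolding n by blast
  have "real P * (\<Sum>i = s..<s + Suc L. real (card (N i))) \<le> real P * (2 * \<rho> / 5)"
    using \<open>5 * real n \<le> 2 * \<rho> * real P\<close> by (intro order_trans[OF block]) (simp add: mult_ac)
  then have light: "(\<Sum>i = s..<s + Suc L. real (card (N i))) \<le> 2 * \<rho> / 5"
    using \<open>P > 0\<close> by simp
  have small: "real (card (N i)) + real (card (N (Suc i))) \<le> 2 * \<rho> / 5"
    if "s \<le> i" "i < s + L" for i
  proof -
    have "real (card (N i)) + real (card (N (Suc i))) = (\<Sum>i\<in>{i, Suc i}. real (card (N i)))"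
      by simp
    also have "\<dots> \<le> (\<Sum>i = s..<s + Suc L. real (card (N i)))"
      using that by (intro sum_mono2) auto
    finally show ?thesis using light by linarith
  qed
  \<comment> \<open>The middle of the run, at distance at least \<open>j\<close> from both of its end cuts.\<close>
  define j where "j = (L - 1) div 2"
  define i where "i = s + j"
  have j: "i + j < s + L" "L \<le> 2 * j + 2" using L(1) by (auto simp: i_def j_def)
  have "i \<le> R" using s j by simp
  have cut_i: "cut i \<le> (\<rho> / 5)\<^sup>2 / 4 ^ j"
    using s small j by (intro cut_decay[of s L]) (auto simp: i_def)

  \<comment> \<open>At \<open>v\<close> the equation reads \<open>\<rho> = cut 0\<close>, which forces mass \<open>\<rho>\<^sup>2 / n\<close> onto the first layer.\<close>
  have "mass 0 = 1" using root by (simp add: mass_def)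
  then have "\<rho>\<^sup>2 \<le> real (card (N (Suc 0))) * mass (Suc 0)"
    using eigen_mass_0 cut_squared_le[of 0] root(1) by simp
  also have "\<dots> \<le> real n * mass (Suc 0)"
    unfolding n using fin sub by (intro mult_right_mono mass_nonneg of_nat_mono card_mono)
  also have "\<dots> \<le> real n * (\<Sum>j\<le>i. mass j)"
    using s(1) mass_nonneg by (intro mult_left_mono member_le_sum) (auto simp: i_def)
  finally have ball: "\<rho>\<^sup>2 \<le> real n * (\<Sum>j\<le>i. mass j)" .

  have "2 powr t \<le> 2 powr real (2 * j + 3)"
    using L j by (intro powr_mono) auto
  also have "\<dots> = 2 ^ (2 * j + 3)"
    by (rule powr_realpow) simp
  also have "\<dots> = 8 * 4 ^ j"
    by (simp add: power_add power_mult)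
  finally have pow: "2 powr t \<le> 8 * 4 ^ j" .
  show ?thesis
  proof (cases "\<rho> + \<mu> \<le> 0")
    case True
    then have "(\<rho> + \<mu>) / real n \<le> 0" by (simp add: divide_nonpos_nonneg)
    then show ?thesis by (smt (verit) powr_gt_zero)
  next
    case False
    have "(\<rho> + \<mu>) * \<rho>\<^sup>2 \<le> (\<rho> + \<mu>) * (real n * (\<Sum>j\<le>i. mass j))"
      using ball False by (intro mult_left_mono) auto
    also have "\<dots> = real n * ((\<rho> + \<mu>) * (\<Sum>j\<le>i. mass j))" by simp
    also have "\<dots> \<le> real n * ((\<rho> / 5)\<^sup>2 / 4 ^ j)"
      using smallest_eigenvalue_cut[OF \<open>i \<le> R\<close> low] cut_i by (intro mult_left_mono) auto
    finally have "(\<rho> + \<mu>) * \<rho>\<^sup>2 \<le> (real n / (25 * 4 ^ j)) * \<rho>\<^sup>2"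
      by (simp add: power_divide)
    then have "\<rho> + \<mu> \<le> real n / (25 * 4 ^ j)"
      by (rule mult_right_le_imp_le) (use \<open>\<rho> > 0\<close> in simp)
    then have "(\<rho> + \<mu>) / real n \<le> 1 / (25 * 4 ^ j)"
      using n_pos by (simp add: field_simps)
    also have "\<dots> \<le> 4 / (8 * 4 ^ j)" by (simp add: field_simps)
    also have "\<dots> \<le> 4 / 2 powr t" using pow by (intro divide_left_mono) auto
    also have "\<dots> = 4 * 2 powr (- t)" by (simp add: powr_minus divide_inverse)
    finally show ?thesis by (simp add: t_def)
  qed
qed

end

theorem proposition1p6:
  fixes G :: "'a pair_pre_digraph" and vs :: "'a list" and k n :: nat
  assumes "k \<ge> 100" and "odd k"
    and "pair_graph G"
    and "distinct vs" and "set vs = pverts G"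
    and "n = card (pverts G)" and "n \<ge> 1"
    and "odd_girth G \<ge> enat k"
    and "eig (adjacency_mat G vs) 1 \<ge> 16 * real n / real k"
  shows "(eig (adjacency_mat G vs) 1 + eig (adjacency_mat G vs) n) / real n
           \<le> 4 * 2 powr (- (real k * eig (adjacency_mat G vs) 1 / (16 * real n)))"
proof -
  interpret pair_graph G by fact
  define a :: "'a \<Rightarrow> 'a \<Rightarrow> real" where "a = (\<lambda>u w. if (u, w) \<in> parcs G then 1 else 0)"
  define A where "A = adjacency_mat G vs"
  have A: "A = mat (length vs) (length vs) (\<lambda>(i, j). a (vs ! i) (vs ! j))"
    by (simp add: A_def adjacency_mat_def a_def)
  have len: "length vs = n" using assms(4-6) distinct_card by metis
  then have "vs \<noteq> []" using assms(7) by auto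
  have symE: "sym (parcs G)" using pair_sym_arcs by (simp add: symmetric_def)
  then have sym: "a u w = a w u" for u w by (auto simp: a_def dest: symD)
  have nonneg: "a u w \<ge> 0" for u w by (simp add: a_def)
  obtain v x where v: "v \<in> set vs" "x v = 1"
    and x: "\<And>u. u \<in> set vs \<Longrightarrow> 0 \<le> x u \<and> x u \<le> 1"
    and eigen: "\<And>u. u \<in> set vs \<Longrightarrow> (\<Sum>w\<in>set vs. a u w * x w) = eig A 1 * x u"
    using perron_and_min_rayleigh(1)[of vs a, OF assms(4) \<open>vs \<noteq> []\<close> sym nonneg]
    unfolding A by blast
  have low: "eig A n * (\<Sum>u\<in>set vs. (g u)\<^sup>2) \<le> quad (set vs) a g" for g
    using perron_and_min_rayleigh(2)[of vs a, OF assms(4) \<open>vs \<noteq> []\<close> sym nonneg]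
    unfolding A len .
  define N where "N = layer (parcs G) v"
  define R where "R = (k - 3) div 2"
  have R: "2 * R + 3 = k" using assms(1,2) unfolding R_def by presburger
  interpret layering "set vs" a x "eig A 1" N R
  proof
    show "N i \<subseteq> set vs" for i
    proof
      fix w assume "w \<in> N i"
      then show "w \<in> set vs"
        using v(1) by (cases i) (auto simp: N_def layer_def assms(5) dest: in_arcsD2)
    qed
    show "w \<in> N (Suc i) \<or> (\<exists>j. i = Suc j \<and> w \<in> N j)"
      if "i \<le> R" "u \<in> N i" "w \<in> set vs" "a u w \<noteq> 0" for i u w
    proof -
      have uw: "(u, w) \<in> parcs G" using that(4) by (auto simp: a_def split: if_splits)
      moreover have "w \<notin> N i"
        using layer_independent[OF assms(3,8), of i v u w] that(1,2) R v(1) uw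
        by (auto simp: N_def assms(5))
      ultimately show ?thesis
        using layer_neighbour[OF symE, of u v i w] that(2) by (auto simp: N_def)
    qed
  qed (use sym x eigen in \<open>auto simp: a_def N_def layer_disjoint\<close>)
  show ?thesis
    using eigenvalue_sum_bound[of v n "eig A n" k] v(2) low assms(1,5,6,9) R
    by (simp add: A_def N_def layer_0)
qed

end
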